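(* Let $T_n=\frac{1}{n+1}\binom{3n+1}{n}$ for $n\ge 0$, and for a prime $p$ and $m\ge1$ let $N_{p,m}:=\#\{0\le n<p^m : p\nmid T_n\}$. For every $m\ge1$, $$N_{2,m}=\mathcal{F}_{m+1},\qquad N_{3,m}=\binom{m+2}{2},$$ and for every prime $p\ge5$, $$N_{p,m}=\frac{p+3}{2}\left(\frac{p+1}{2}\right)^{m-1}.$$
   Context: Fibonacci numbers: $\mathcal{F}_0=0$, $\mathcal{F}_1=1$, $\mathcal{F}_{n+1}=\mathcal{F}_n+\mathcal{F}_{n-1}$. *)

theory Defs
  imports Complex_Main "HOL-Number_Theory.Number_Theory"
begin

text \<open>The division below is exact; see \<open>Suc_dvd_binomial\<close> and \<open>of_nat_T_seq\<close>.\<close>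

definition T_seq :: "nat \<Rightarrow> nat" where
  "T_seq n = ((3 * n + 1) choose n) div (n + 1)"

lemma Suc_dvd_binomial: "n + 1 dvd ((3 * n + 1) choose n)"
proof -
  have "(n + 1) * ((3 * n + 1) choose (n + 1)) = (2 * n + 1) * ((3 * n + 1) choose n)"
    using binomial_absorb_comp[of "3 * n + 1" n] binomial_absorption[of n "3 * n + 1"]
    by simp
  then have "n + 1 dvd (2 * n + 1) * ((3 * n + 1) choose n)"
    by (metis dvd_triv_left)
  moreover have "coprime (n + 1) (2 * n + 1)"
  proof -
    have "coprime (n + 1) ((n + 1) + n)"
      by (simp only: coprime_iff_gcd_eq_1 gcd_add2) simp
    then show ?thesis by (simp add: mult_2)
  qed
  ultimately show ?thesis
    by (simp only: coprime_dvd_mult_right_iff)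
qed

lemma of_nat_T_seq:
  "(of_nat (T_seq n) :: 'a :: field_char_0) = 1 / of_nat (n + 1) * of_nat ((3 * n + 1) choose n)"
  unfolding T_seq_def using Suc_dvd_binomial[of n] by (simp only: field_char_0_class.of_nat_div) (simp add: mod_eq_0_iff_dvd)

definition N_count :: "nat \<Rightarrow> nat \<Rightarrow> nat" where
  "N_count p m = card {n. n < p ^ m \<and> \<not> p dvd T_seq n}"

end

theory Submission
  imports Defs
begin

text \<open>Since \<open>n + 1\<close> and \<open>2n + 1\<close> are coprime, \<open>p\<close> fails to divide \<open>T_n\<close> iff it fails to divide
  one of \<open>(n + 1) T_n = (3n+1 choose n)\<close> and \<open>(2n + 1) T_n = (3n+1 choose n+1)\<close>. By Lucas' theorem,
  non-divisibility of the binomials \<open>(3n choose n)\<close>, \<open>(3n+1 choose n)\<close> and \<open>(3n+2 choose n+1)\<close> by \<open>p\<close>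
  is decided by a finite automaton reading the base-\<open>p\<close> digits of \<open>n\<close>, which turns the counts
  into a linear recurrence in \<open>m\<close>.\<close>

section \<open>Lucas' theorem\<close>

text \<open>Vandermonde's convolution expands the left side, and \<open>p\<close> divides
  \<open>p choose i\<close> for 0 < i < p, so only the terms i = 0 and i = p survive. This is (1 +
  x)^p = 1 + x^p read off at one coefficient.\<close>

lemma prime_add_choose_cong:
  fixes p n k :: nat
  assumes "prime p"
  shows "[(p + n) choose k = (n choose k) + (if p \<le> k then n choose (k - p) else 0)] (mod p)"
proof -
  have p0: "p > 0" using assms prime_gt_0_nat by blast
  have "[(\<Sum>i\<le>k. (p choose i) * (n choose (k - i))) =
         (\<Sum>i\<le>k. (if i = 0 then n choose k else 0) + (if i = p then n choose (k - p) else 0))] (mod p)"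
  proof (rule cong_sum)
    fix i assume "i \<in> {..k}"
    consider "i = 0" | "i = p" | "0 < i" "i < p" | "i > p" by linarith
    then show "[(p choose i) * (n choose (k - i)) =
         (if i = 0 then n choose k else 0) + (if i = p then n choose (k - p) else 0)] (mod p)"
    proof cases
      case 3
      then have "p dvd p choose i" using assms by (intro dvd_choose_prime) auto
      then show ?thesis using 3 by (simp add: cong_0_iff)
    qed (use p0 in \<open>auto simp: binomial_eq_0\<close>)
  qed
  also have "(\<Sum>i\<le>k. (if i = 0 then n choose k else 0) + (if i = p then n choose (k - p) else 0))
           = (n choose k) + (if p \<le> k then n choose (k - p) else 0)"
    by (simp add: sum.distrib)
  finally show ?thesis by (simp add: vandermonde)
qed

text \<open>The preceding congruence acts as Pascal's rule on the leading part \<open>a\<close>: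
  removing one \<open>p\<close> from the upper argument leaves the terms for \<open>c\<close> and
  \<open>c - 1\<close>, which recombine by Pascal's rule for \<open>a choose c\<close>.\<close>

theorem Lucas:
  fixes p a b c d :: nat
  assumes "prime p" "b < p" "d < p"
  shows "[(p * a + b) choose (p * c + d) = (a choose c) * (b choose d)] (mod p)"
proof (induction a arbitrary: c)
  case 0
  show ?case
  proof (cases c)
    \<comment> \<open>Here \<open>b < p \<le> p * c + d\<close>, so both sides vanish.\<close>
    case (Suc c')
    then show ?thesis using assms by (simp add: binomial_eq_0)
  qed simp
next
  case (Suc a)
  have *: "[(p * Suc a + b) choose (p * c + d) = ((p * a + b) choose (p * c + d)) +
      (if p \<le> p * c + d then (p * a + b) choose (p * c + d - p) else 0)] (mod p)"
    using prime_add_choose_cong[OF assms(1), of "p * a + b" "p * c + d"] by (simp add: add.assoc)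
  show ?case
  proof (cases c)
    case 0
    then show ?thesis using * Suc.IH[of 0] assms by (simp add: cong_def)
  next
    case c: (Suc c')
    then have "[(p * Suc a + b) choose (p * c + d) = ((p * a + b) choose (p * c + d)) +
       ((p * a + b) choose (p * c' + d))] (mod p)"
      using * by simp
    also have "[((p * a + b) choose (p * c + d)) + ((p * a + b) choose (p * c' + d)) =
       (a choose c) * (b choose d) + (a choose c') * (b choose d)] (mod p)"
      by (intro cong_add Suc.IH)
    finally show ?thesis using c by (simp add: algebra_simps)
  qed
qed

text \<open>For \<open>b < p\<close> the factor \<open>b choose d\<close> divides
  \<open>fact b\<close>, which is prime to \<open>p\<close>, unless \<open>d > b\<close> makes it
  zero.\<close>

corollary Lucas_not_dvd:
  fixes p a b c d :: nat
  assumes "prime p" "b < p" "d < p"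
  shows "\<not> p dvd ((p * a + b) choose (p * c + d)) \<longleftrightarrow> \<not> p dvd (a choose c) \<and> d \<le> b"
proof -
  have "p dvd ((p * a + b) choose (p * c + d)) \<longleftrightarrow> p dvd (a choose c) * (b choose d)"
    using Lucas[OF assms] by (rule cong_dvd_iff)
  moreover have "\<not> p dvd (b choose d)" if "d \<le> b"
  proof
    assume "p dvd (b choose d)"
    then have "p dvd fact b" using binomial_fact_lemma[OF that] by (metis dvd_mult)
    then show False using assms by (simp add: prime_dvd_fact_iff)
  qed
  moreover have "b choose d = 0" if "\<not> d \<le> b" using that by (simp add: binomial_eq_0)
  ultimately show ?thesis using assms(1) by (cases "d \<le> b") (simp_all add: prime_dvd_mult_iff)
qed

section \<open>The digit automaton\<close>

lemma Suc_mult_T_seq: "(n + 1) * T_seq n = (3 * n + 1) choose n"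
  unfolding T_seq_def using Suc_dvd_binomial[of n] by (simp only: dvd_mult_div_cancel)

lemma odd_mult_T_seq: "(2 * n + 1) * T_seq n = (3 * n + 1) choose (n + 1)"
proof -
  have "(n + 1) * ((3 * n + 1) choose (n + 1)) = (2 * n + 1) * ((3 * n + 1) choose n)"
    using binomial_absorb_comp[of "3 * n + 1" n] binomial_absorption[of n "3 * n + 1"]
    by simp
  also have "\<dots> = (n + 1) * ((2 * n + 1) * T_seq n)"
    by (simp only: Suc_mult_T_seq[symmetric] mult.left_commute)
  finally show ?thesis by (simp only: mult_cancel1) simp
qed

lemma not_dvd_T_seq_iff:
  assumes "prime p"
  shows "\<not> p dvd T_seq n \<longleftrightarrow>
    \<not> p dvd ((3 * n + 1) choose n) \<or> \<not> p dvd ((3 * n + 1) choose (n + 1))"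
proof -
  have "\<not> (p dvd n + 1 \<and> p dvd 2 * n + 1)"
  proof
    assume "p dvd n + 1 \<and> p dvd 2 * n + 1"
    \<comment> \<open>The difference equals 1, which gives the coprimality.\<close>
    then have "p dvd 2 * (n + 1) - (2 * n + 1)" by (meson dvd_diff_nat dvd_mult)
    then show False using assms by simp
  qed
  then show ?thesis
    unfolding Suc_mult_T_seq[symmetric] odd_mult_T_seq[symmetric]
    using assms by (auto simp only: prime_dvd_mult_iff)
qed

context
  fixes p :: nat
  assumes p: "prime p"
begin

text \<open>These are the states of the automaton. In \<open>a_nz\<close> and \<open>b_nz\<close>
  the lower digit carried 0 or 1 into the upper argument; in \<open>d_nz\<close> it carried 2 into
  the upper and 1 into the lower argument.\<close>

definition a_nz :: "nat \<Rightarrow> bool" where "a_nz n \<longleftrightarrow> \<not> p dvd ((3 * n) choose n)"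
definition b_nz :: "nat \<Rightarrow> bool" where "b_nz n \<longleftrightarrow> \<not> p dvd ((3 * n + 1) choose n)"
definition d_nz :: "nat \<Rightarrow> bool" where "d_nz n \<longleftrightarrow> \<not> p dvd ((3 * n + 2) choose (n + 1))"

text \<open>The quotient \<open>(3r + c) div p\<close> is carried into the next digit. The hypothesis
  \<open>c \<le> 2e + 1\<close> rules out a carry of 2: it would leave the digit \<open>3r + c - 2p < r + e\<close>, so by Lucas
  the binomial vanishes mod \<open>p\<close>.\<close>

lemma not_dvd_choose_digit:
  assumes "r + e < p" "c < 3" "c \<le> 2 * e + 1"
  shows "\<not> p dvd ((3 * (p * q + r) + c) choose (p * q + r + e)) \<longleftrightarrow>
    (3 * r + c < p \<and> r + e \<le> 3 * r + c \<and> a_nz q) \<or>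
    (p \<le> 3 * r + c \<and> 3 * r + c < 2 * p \<and> p + e \<le> 2 * r + c \<and> b_nz q)"
proof -
  \<comment> \<open>\<open>k\<close> is the carry and \<open>s\<close> the last digit of the upper
    argument; Lucas separates them.\<close>
  have L: "\<not> p dvd ((3 * (p * q + r) + c) choose (p * q + r + e)) \<longleftrightarrow>
     \<not> p dvd ((3 * q + k) choose q) \<and> r + e \<le> s"
    if "3 * r + c = p * k + s" "s < p" for k s
  proof -
    have "3 * (p * q + r) + c = p * (3 * q + k) + s" using that by (simp add: algebra_simps)
    then show ?thesis using Lucas_not_dvd[OF p that(2) assms(1), of "3 * q + k" q]
      by (simp add: add.assoc)
  qed
  consider "3 * r + c < p" | "p \<le> 3 * r + c" "3 * r + c < 2 * p" | "2 * p \<le> 3 * r + c" by linarith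
  then show ?thesis
  proof cases
    case 1
    then show ?thesis using L[of 0 "3 * r + c"] by (auto simp: a_nz_def)
  next
    case 2
    then show ?thesis using L[of 1 "3 * r + c - p"] by (auto simp: b_nz_def)
  next
    case 3
    then have "3 * r + c = p * 2 + (3 * r + c - 2 * p)" "3 * r + c - 2 * p < p"
      using assms by auto
    from L[OF this] show ?thesis using 3 assms by auto
  qed
qed

lemma a_nz_digit:
  assumes "r < p"
  shows "a_nz (p * q + r) \<longleftrightarrow>
    (3 * r < p \<and> a_nz q) \<or> (3 * r < 2 * p \<and> p \<le> 2 * r \<and> b_nz q)"
  using not_dvd_choose_digit[of r 0 0 q] assms by (auto simp: a_nz_def[of "p * q + r"])

lemma b_nz_digit:
  assumes "r < p"
  shows "b_nz (p * q + r) \<longleftrightarrow>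
    (3 * r + 1 < p \<and> a_nz q) \<or> (3 * r + 1 < 2 * p \<and> p \<le> 2 * r + 1 \<and> b_nz q)"
  using not_dvd_choose_digit[of r 0 1 q] assms by (auto simp: b_nz_def[of "p * q + r"])

text \<open>Adding 1 to the digit \<open>p - 1\<close> carries into the lower argument and leaves
  the digit 0 there, so the digit comparison in Lucas is automatic. The upper argument carries
  2.\<close>

lemma not_dvd_choose_top_digit:
  assumes "c \<in> {1, 2}" "c \<le> p"
  shows "\<not> p dvd ((3 * (p * q + (p - 1)) + c) choose (p * q + (p - 1) + 1)) \<longleftrightarrow> d_nz q"
proof -
  have p2: "p \<ge> 2" using p prime_ge_2_nat by blast
  have *: "3 * (p * q + (p - 1)) + c = p * (3 * q + 2) + (p + c - 3)"
          "p * q + (p - 1) + 1 = p * (q + 1) + 0"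
    using p2 assms by (auto simp: algebra_simps)
  show ?thesis unfolding * d_nz_def
    using p2 assms by (subst Lucas_not_dvd[OF p]) auto
qed

lemma d_nz_digit:
  assumes "r < p"
  shows "d_nz (p * q + r) \<longleftrightarrow>
    (3 * r + 2 < p \<and> a_nz q) \<or> (3 * r + 2 < 2 * p \<and> p \<le> 2 * r + 1 \<and> b_nz q) \<or>
    (r = p - 1 \<and> d_nz q)"
proof (cases "r = p - 1")
  case True
  have "p \<ge> 2" using p prime_ge_2_nat by blast
  with True show ?thesis
    using not_dvd_choose_top_digit[of 2 q] by (simp only: d_nz_def[of "p * q + (p - 1)"]) auto
next
  case False
  then show ?thesis
    using not_dvd_choose_digit[of r 1 2 q] assms by (auto simp: d_nz_def[of "p * q + r"])
qed

text \<open>For \<open>r < p - 1\<close> the binomial with lower index \<open>n + 1\<close> requires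
  \<open>p \<le> 2 * r\<close> in the carry-1 case, so it adds nothing to \<open>b_nz\<close>. For
  \<open>r = p - 1\<close> the \<open>b_nz\<close> conditions fail and only \<open>d_nz q\<close>
  remains.\<close>

lemma not_dvd_T_seq_digit:
  assumes "r < p"
  shows "\<not> p dvd T_seq (p * q + r) \<longleftrightarrow>
    (3 * r + 1 < p \<and> a_nz q) \<or> (3 * r + 1 < 2 * p \<and> p \<le> 2 * r + 1 \<and> b_nz q) \<or>
    (r = p - 1 \<and> d_nz q)"
proof -
  have p2: "p \<ge> 2" using p prime_ge_2_nat by blast
  have T: "\<not> p dvd T_seq (p * q + r) \<longleftrightarrow> b_nz (p * q + r) \<or>
      \<not> p dvd ((3 * (p * q + r) + 1) choose (p * q + r + 1))"
    using not_dvd_T_seq_iff[OF p] by (simp only: b_nz_def)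
  show ?thesis
  proof (cases "r = p - 1")
    case True
    then show ?thesis
      using not_dvd_choose_top_digit[of 1 q] p2 T b_nz_digit[OF assms] by auto
  next
    case False
    then show ?thesis
      using not_dvd_choose_digit[of r 1 1 q] assms T b_nz_digit[OF assms] by auto
  qed
qed

section \<open>Counting\<close>

definition digit_count :: "nat \<Rightarrow> (nat \<Rightarrow> bool) \<Rightarrow> nat" where
  "digit_count m P = card {n. n < p ^ m \<and> P n}"

lemma digit_count_0: "digit_count 0 P = (if P 0 then 1 else 0)"
proof -
  have "{n. n < p ^ 0 \<and> P n} = (if P 0 then {0} else {})" by auto
  then show ?thesis by (simp add: digit_count_def)
qed

text \<open>Division with remainder by \<open>p\<close> splits off the least significant
  digit.\<close>

lemma digit_count_Suc: "digit_count (Suc m) P = (\<Sum>r<p. digit_count m (\<lambda>q. P (p * q + r)))"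
proof -
  have p0: "p > 0" using p prime_gt_0_nat by blast
  have less: "p * q + r < p ^ Suc m \<longleftrightarrow> q < p ^ m" if "r < p" for q r
  proof -
    have "q < p ^ m \<longleftrightarrow> (p * q + r) div p < p ^ m" using that by simp
    also have "\<dots> \<longleftrightarrow> p * q + r < p ^ Suc m"
      using p0 by (simp only: div_less_iff_less_mult power_Suc mult.commute[of p "p ^ m"])
    finally show ?thesis by simp
  qed
  have "bij_betw (\<lambda>(r, q). p * q + r) (SIGMA r:{..<p}. {q. q < p ^ m \<and> P (p * q + r)})
          {n. n < p ^ Suc m \<and> P n}" (is "bij_betw ?f ?S ?N")
  proof (rule bij_betwI[of _ _ _ "\<lambda>n. (n mod p, n div p)"])
    show "?f \<in> ?S \<rightarrow> ?N"
    proof (rule funcsetI)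
      fix x assume "x \<in> ?S"
      then obtain r q where "x = (r, q)" "r < p" "q < p ^ m" "P (p * q + r)" by blast
      then show "?f x \<in> ?N" using less[of r q] by (simp only: prod.case mem_Collect_eq)
    qed
    show "(\<lambda>n. (n mod p, n div p)) \<in> ?N \<rightarrow> ?S"
    proof (rule funcsetI)
      fix n assume n: "n \<in> ?N"
      have "n mod p < p" using p0 by simp
      moreover have "p * (n div p) + n mod p = n" by simp
      ultimately show "(n mod p, n div p) \<in> ?S"
        using n less[of "n mod p" "n div p"] by (simp only: mem_Sigma_iff lessThan_iff mem_Collect_eq)
    qed
  qed auto
  then have "digit_count (Suc m) P = card (SIGMA r:{..<p}. {q. q < p ^ m \<and> P (p * q + r)})"
    unfolding digit_count_def by (rule bij_betw_same_card[symmetric])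
  also have "\<dots> = (\<Sum>r<p. digit_count m (\<lambda>q. P (p * q + r)))"
    unfolding digit_count_def by (subst card_SigmaI) auto
  finally show ?thesis .
qed

text \<open>Each digit leads to at most one state, so counting transitions gives the recurrence:
  \<open>k\<close> digits lead to \<open>A\<close>, \<open>j - i\<close> to \<open>B\<close> and the
  digit \<open>p - 1\<close> to \<open>D\<close>.\<close>

lemma digit_count_Suc_automaton:
  assumes "\<And>q r. r < p \<Longrightarrow> P (p * q + r) \<longleftrightarrow> (r < k \<and> A q) \<or> (i \<le> r \<and> r < j \<and> B q) \<or> (p = Suc r \<and> D q)"
    and "k \<le> i" "k < p" "j \<le> p" "\<And>q. j = p \<Longrightarrow> \<not> D q"
  shows "digit_count (Suc m) P = k * digit_count m A + (j - i) * digit_count m B + digit_count m D"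
proof -
  have "digit_count m (\<lambda>q. P (p * q + r)) = (if r < k then digit_count m A else 0) +
      (if i \<le> r \<and> r < j then digit_count m B else 0) + (if r = p - 1 then digit_count m D else 0)"
    if "r < p" for r
  \<comment> \<open>For \<open>j < p\<close> the three digit ranges are disjoint. For
    \<open>j = p\<close> the digit \<open>p - 1\<close> may lie in the second range too, but then
    \<open>D\<close> is never true.\<close>
  proof (cases "j = p")
    case True
    then show ?thesis using that assms(2-) by (auto simp: assms(1) digit_count_def)
  next
    case False
    then show ?thesis using that assms(2-4) by (auto simp: assms(1) digit_count_def)
  qed
  then have "digit_count (Suc m) P = (\<Sum>r<p. (if r \<in> {..<k} then digit_count m A else 0) +
      (if r \<in> {i..<j} then digit_count m B else 0) + (if r = p - 1 then digit_count m D else 0))"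
    by (simp add: digit_count_Suc)
  also have "\<dots> = (\<Sum>r\<in>{..<p} \<inter> {..<k}. digit_count m A) + (\<Sum>r\<in>{..<p} \<inter> {i..<j}. digit_count m B) + digit_count m D"
    using assms(3) by (simp only: sum.distrib sum.inter_restrict finite_lessThan sum.delta) auto
  also have "{..<p} \<inter> {..<k} = {..<k}"
    using assms(3) by auto
  also have "{..<p} \<inter> {i..<j} = {i..<j}"
    using assms(4) by auto
  finally show ?thesis by simp
qed

lemma N_count_eq: "N_count p m = digit_count m (\<lambda>n. \<not> p dvd T_seq n)"
  by (simp add: N_count_def digit_count_def)

text \<open>This reduces each prime to finding thresholds: \<open>c\<close> and \<open>e\<close> are
  the constants in the digit conditions of the state, and \<open>k\<close>, \<open>i\<close>,
  \<open>j\<close> solve those inequalities for \<open>r\<close>.\<close>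

lemma digit_count_abd:
  assumes *: "\<And>r. 3 * r + c < p \<longleftrightarrow> r < k"
             "\<And>r. (3 * r + c < 2 * p \<and> p \<le> 2 * r + e) \<longleftrightarrow> (i \<le> r \<and> r < j)"
    and "k \<le> i" "k < p" "j \<le> p"
  shows "c = 0 \<Longrightarrow> e = 0 \<Longrightarrow>
           digit_count (Suc m) a_nz = k * digit_count m a_nz + (j - i) * digit_count m b_nz"
    and "c = 1 \<Longrightarrow> e = 1 \<Longrightarrow>
           digit_count (Suc m) b_nz = k * digit_count m a_nz + (j - i) * digit_count m b_nz"
    and "c = 2 \<Longrightarrow> e = 1 \<Longrightarrow> j < p \<Longrightarrow> digit_count (Suc m) d_nz =
           k * digit_count m a_nz + (j - i) * digit_count m b_nz + digit_count m d_nz"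
    and "c = 1 \<Longrightarrow> e = 1 \<Longrightarrow> j < p \<Longrightarrow> N_count p (Suc m) =
           k * digit_count m a_nz + (j - i) * digit_count m b_nz + digit_count m d_nz"
proof -
  \<comment> \<open>From \<open>a_nz\<close> and \<open>b_nz\<close> no digit leads to
    \<open>d_nz\<close>, so their third target is the constantly false state.\<close>
  have False0: "digit_count m (\<lambda>_. False) = 0" by (simp add: digit_count_def)
  have conj: "(3 * r + c < 2 * p \<and> p \<le> 2 * r + e \<and> Q) \<longleftrightarrow> (i \<le> r \<and> r < j \<and> Q)" for r Q
    using *(2)[of r] by blast
  have top: "r = p - 1 \<longleftrightarrow> p = Suc r" for r
    using prime_gt_0_nat[OF p] by auto
  show "digit_count (Suc m) a_nz = k * digit_count m a_nz + (j - i) * digit_count m b_nz"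
    if ce: "c = 0" "e = 0"
    using digit_count_Suc_automaton[of a_nz k a_nz i j b_nz "\<lambda>_. False" m] assms(3-) False0
      *(1) conj a_nz_digit unfolding ce by simp
  show "digit_count (Suc m) b_nz = k * digit_count m a_nz + (j - i) * digit_count m b_nz"
    if ce: "c = 1" "e = 1"
    using digit_count_Suc_automaton[of b_nz k a_nz i j b_nz "\<lambda>_. False" m] assms(3-) False0
      *(1) conj b_nz_digit unfolding ce by simp
  show "digit_count (Suc m) d_nz =
           k * digit_count m a_nz + (j - i) * digit_count m b_nz + digit_count m d_nz"
    if ce: "c = 2" "e = 1" and "j < p"
    by (rule digit_count_Suc_automaton)
       (use that(3) assms(3-) *(1) conj d_nz_digit in \<open>auto simp only: ce top\<close>)
  show "N_count p (Suc m) =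
           k * digit_count m a_nz + (j - i) * digit_count m b_nz + digit_count m d_nz"
    if ce: "c = 1" "e = 1" and "j < p"
    unfolding N_count_eq
    by (rule digit_count_Suc_automaton)
       (use that(3) assms(3-) *(1) conj not_dvd_T_seq_digit in \<open>auto simp only: ce top\<close>)
qed

text \<open>Only n = 0 is counted; the three binomials there are 1, 1 and 2, whence the exception at
  \<open>p = 2\<close>.\<close>

lemma digit_count_0_abd:
  shows "digit_count 0 a_nz = 1" "digit_count 0 b_nz = 1"
    and "digit_count 0 d_nz = (if p = 2 then 0 else 1)"
proof -
  have "\<not> p dvd 1" using p by auto
  moreover have "p dvd 2 \<longleftrightarrow> p = 2"
    using p by (metis dvd_refl primes_dvd_imp_eq two_is_prime_nat)
  ultimately show "digit_count 0 a_nz = 1" "digit_count 0 b_nz = 1"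
    "digit_count 0 d_nz = (if p = 2 then 0 else 1)"
    by (simp_all add: digit_count_0 a_nz_def b_nz_def d_nz_def numeral_2_eq_2)
qed

end

section \<open>Solving the recurrences for p = 2, p = 3 and p \<ge> 5\<close>

lemma N_count_2: "N_count 2 (Suc m) = fib (m + 2)"
proof -
  note p = two_is_prime_nat
  \<comment> \<open>The numbers after \<open>of\<close> are \<open>c\<close>, \<open>k\<close>,
    \<open>e\<close>, \<open>i\<close>, \<open>j\<close>; \<open>i = j\<close> means that no digit
    leads to \<open>b_nz\<close>.\<close>
  have a: "digit_count 2 (Suc m) (a_nz 2) = digit_count 2 m (a_nz 2) + digit_count 2 m (b_nz 2)" for m
    by (subst digit_count_abd(1)[OF p, of 0 1 0 1 2]) auto
  have b: "digit_count 2 (Suc m) (b_nz 2) = digit_count 2 m (a_nz 2)" for m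
    by (subst digit_count_abd(2)[OF p, of 1 1 1 1 1]) auto
  have d: "digit_count 2 (Suc m) (d_nz 2) = digit_count 2 m (d_nz 2)" for m
    by (subst digit_count_abd(3)[OF p, of 2 0 1 1 1]) auto
  have N: "N_count 2 (Suc m) = digit_count 2 m (a_nz 2) + digit_count 2 m (d_nz 2)" for m
    by (subst digit_count_abd(4)[OF p, of 1 1 1 1 1]) auto
  have "digit_count 2 m (a_nz 2) = fib (m + 2) \<and> digit_count 2 m (b_nz 2) = fib (m + 1) \<and>
        digit_count 2 m (d_nz 2) = 0"
    by (induction m) (simp_all add: a b d digit_count_0_abd[OF p])
  then show ?thesis by (simp add: N)
qed

text \<open>The recurrence is triangular: the counts for \<open>a_nz\<close>, \<open>b_nz\<close>
  and \<open>d_nz\<close> are constant, linear and quadratic in \<open>m\<close>, each summing the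
  earlier ones.\<close>

lemma N_count_3: "N_count 3 (Suc m) = (m + 3) choose 2"
proof -
  have p: "prime (3 :: nat)" by simp
  have a: "digit_count 3 (Suc m) (a_nz 3) = digit_count 3 m (a_nz 3)" for m
    by (subst digit_count_abd(1)[OF p, of 0 1 0 2 2]) auto
  have b: "digit_count 3 (Suc m) (b_nz 3) = digit_count 3 m (a_nz 3) + digit_count 3 m (b_nz 3)" for m
    by (subst digit_count_abd(2)[OF p, of 1 1 1 1 2]) auto
  have d: "digit_count 3 (Suc m) (d_nz 3) =
      digit_count 3 m (a_nz 3) + digit_count 3 m (b_nz 3) + digit_count 3 m (d_nz 3)" for m
    by (subst digit_count_abd(3)[OF p, of 2 1 1 1 2]) auto
  have N: "N_count 3 (Suc m) =
      digit_count 3 m (a_nz 3) + digit_count 3 m (b_nz 3) + digit_count 3 m (d_nz 3)" for m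
    by (subst digit_count_abd(4)[OF p, of 1 1 1 1 2]) auto
  have "digit_count 3 m (a_nz 3) = 1 \<and> digit_count 3 m (b_nz 3) = m + 1 \<and>
        digit_count 3 m (d_nz 3) = (m + 2) choose 2"
    by (induction m) (simp_all add: a b d digit_count_0_abd[OF p] numeral_2_eq_2)
  then have "N_count 3 (Suc m) = (m + 2) + ((m + 2) choose 2)" by (simp only: N)
  also have "\<dots> = Suc (m + 2) choose 2" by (simp add: numeral_2_eq_2)
  finally show ?thesis by (simp add: numeral_3_eq_3)
qed

text \<open>The counts for \<open>a_nz\<close> and \<open>b_nz\<close> start equal and stay equal,
  so only the total number of digits leading to either matters. With
  \<open>h = (p + 1) div 2\<close> it is \<open>h\<close>, or \<open>h - 1\<close> from
  \<open>d_nz\<close>, where the digit \<open>p - 1\<close> makes up the difference.\<close>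

lemma N_count_ge_5:
  assumes p: "prime p" and "p \<ge> 5"
  shows "N_count p (Suc m) = ((p + 3) div 2) * ((p + 1) div 2) ^ m"
proof -
  have "\<not> 2 dvd p" "\<not> 3 dvd p"
    using primes_dvd_imp_eq[OF _ p, of 2] primes_dvd_imp_eq[OF _ p, of 3] assms(2) by auto
  then have "p mod 6 = 1 \<or> p mod 6 = 5" by presburger
  then obtain j where j: "p = 6 * j + 1 \<or> p = 6 * j + 5"
    by (metis mult_div_mod_eq)
  define h where "h = (p + 1) div 2"
  have h: "h \<ge> 1" using assms(2) by (simp add: h_def)
  have div_values: "Suc (6 * j) div 3 = 2 * j" "Suc (Suc (12 * j)) div 3 = 4 * j"
    "(6 * j + 5) div 3 = 2 * j + 1" "(12 * j + 10) div 3 = 4 * j + 3" "(5 + 6 * j) div 2 = 3 * j + 2"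
    by linarith+
  \<comment> \<open>The thresholds are the ceilings of (p - c)/3, (p - e)/2 and (2p - c)/3. Their
    denominators are why p is split modulo 6.\<close>
  have carry: "(p + 2 - c) div 3 + ((2 * p + 2 - c) div 3 - (p + 1 - e) div 2) = (if c = 2 then h - 1 else h)"
    "(p + 2 - c) div 3 \<le> (p + 1 - e) div 2" "(2 * p + 2 - c) div 3 < p" "(p + 2 - c) div 3 < p"
    if "(c, e) \<in> {(0, 0), (1, 1), (2, 1)}" for c e
    using that assms(2) j by (auto simp: h_def div_values)
  have iff: "3 * r + c < p \<longleftrightarrow> r < (p + 2 - c) div 3"
    "(3 * r + c < 2 * p \<and> p \<le> 2 * r + e) \<longleftrightarrow> ((p + 1 - e) div 2 \<le> r \<and> r < (2 * p + 2 - c) div 3)"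
    if "(c, e) \<in> {(0, 0), (1, 1), (2, 1)}" for c e r
    using that assms(2) by auto
  have a: "digit_count p (Suc m) (a_nz p) = h * x"
    and b: "digit_count p (Suc m) (b_nz p) = h * x"
    and d: "digit_count p (Suc m) (d_nz p) = (h - 1) * x + digit_count p m (d_nz p)"
    and N: "N_count p (Suc m) = h * x + digit_count p m (d_nz p)"
    if x: "digit_count p m (a_nz p) = x" "digit_count p m (b_nz p) = x" for m x
  proof -
    let ?k = "\<lambda>c. (p + 2 - c) div 3" and ?i = "\<lambda>e. (p + 1 - e) div 2"
      and ?j = "\<lambda>c. (2 * p + 2 - c) div 3"
    have total: "?k c * x + (?j c - ?i e) * x = (if c = 2 then h - 1 else h) * x"
      if "(c, e) \<in> {(0, 0), (1, 1), (2, 1)}" for c e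
      by (simp only: carry(1)[OF that] flip: distrib_right)
    note hyps = iff carry(2,4) less_imp_le[OF carry(3)]
    have ce: "(0, 0) \<in> {(0, 0), (1, 1), (2 :: nat, 1 :: nat)}" "(1, 1) \<in> {(0, 0), (1, 1), (2 :: nat, 1 :: nat)}"
      "(2, 1) \<in> {(0, 0), (1, 1), (2 :: nat, 1 :: nat)}" by simp_all
    show "digit_count p (Suc m) (a_nz p) = h * x"
      using digit_count_abd(1)[OF p hyps[OF ce(1)] refl refl, of m] total[OF ce(1)]
      unfolding x by simp
    show "digit_count p (Suc m) (b_nz p) = h * x"
      using digit_count_abd(2)[OF p hyps[OF ce(2)] refl refl, of m] total[OF ce(2)]
      unfolding x by simp
    show "digit_count p (Suc m) (d_nz p) = (h - 1) * x + digit_count p m (d_nz p)"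
      using digit_count_abd(3)[OF p hyps[OF ce(3)] refl refl carry(3)[OF ce(3)], of m] total[OF ce(3)]
      unfolding x by simp
    show "N_count p (Suc m) = h * x + digit_count p m (d_nz p)"
      using digit_count_abd(4)[OF p hyps[OF ce(2)] refl refl carry(3)[OF ce(2)], of m] total[OF ce(2)]
      unfolding x by simp
  qed
  have "digit_count p m (a_nz p) = h ^ m \<and> digit_count p m (b_nz p) = h ^ m \<and>
        digit_count p m (d_nz p) = h ^ m"
  proof (induction m)
    case 0
    show ?case using assms(2) by (simp add: digit_count_0_abd[OF p])
  next
    case (Suc m)
    then show ?case using a[of m "h ^ m"] b[of m "h ^ m"] d[of m "h ^ m"] h by (cases h) auto
  qed
  then have "N_count p (Suc m) = h * h ^ m + h ^ m" using N[of m "h ^ m"] by simp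
  also have "\<dots> = (h + 1) * h ^ m" by simp
  also have "h + 1 = (p + 3) div 2" by (simp add: h_def)
  finally show ?thesis by (simp only: h_def)
qed

theorem theorem6p1:
  fixes m :: nat
  assumes "m \<ge> 1"
  shows "N_count 2 m = fib (m + 1) \<and>
         N_count 3 m = (m + 2) choose 2 \<and>
         (\<forall>p::nat. prime p \<and> p \<ge> 5 \<longrightarrow>
            real (N_count p m) = (real p + 3) / 2 * ((real p + 1) / 2) ^ (m - 1))"
proof -
  obtain l where m: "m = Suc l" using assms by (cases m) auto
  have "real (N_count p m) = (real p + 3) / 2 * ((real p + 1) / 2) ^ (m - 1)"
    if "prime p" "p \<ge> 5" for p
  proof -
    \<comment> \<open>Oddness makes the natural-number halves exact over the reals.\<close>
    have "odd p" using that prime_odd_nat by force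
    then have "real ((p + 3) div 2) = (real p + 3) / 2" "real ((p + 1) div 2) = (real p + 1) / 2"
      by (auto elim!: oddE)
    then show ?thesis by (simp only: m N_count_ge_5[OF that] of_nat_mult of_nat_power diff_Suc_1)
  qed
  then show ?thesis using N_count_2[of l] N_count_3[of l] by (simp add: m numeral_3_eq_3)
qed

end
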